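(* Let $a>0$, $b\ge0$, $\gamma>0$ and let $L\ge1$ be an integer. Let $\pi(u;\gamma,L)$ be the probability density on $(0,\infty)$ proportional to $$\frac{u^{a-1}}{(1+u)^{a+b}}\left\{\prod_{k=1}^{L-1}\frac1{f_k(1+u)}\right\}\frac1{f_L(1+u)^{1+\gamma}} .$$ Then, as a function of $u>0$, $$\pi(u;\gamma,L)\propto\int_{(0,\infty)^{L+1}}u^{a-1}e^{-t_Lu}\,\mathrm{GS}_L(t_{0:L}\mid\gamma)\,dt_{0:L},$$ where $t_{0:L}=(t_0,t_1,\dots,t_L)$ and $$\mathrm{GS}_L(t_{0:L}\mid\gamma)=\mathrm{Ga}(t_0\mid1+\gamma,1)\left\{\prod_{l=1}^{L-1}\mathrm{Ga}(t_l\mid t_{l-1}+1,1)\right\}\mathrm{Ga}(t_L\mid t_{L-1}+a+b,1).$$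
   Context: For $z\ge1$ define $f_1(z)=f(z)=1+\log z$ and inductively $f_{L+1}(z)=f(f_L(z))=1+\log f_L(z)$ for $L=1,2,\dots$. Empty products equal $1$. $\mathrm{Ga}(t\mid\alpha,\beta)=\frac{\beta^\alpha}{\Gamma(\alpha)}t^{\alpha-1}e^{-\beta t}$, $t>0$, is the gamma density with shape $\alpha$ and rate $\beta$. The symbol $\propto$ means equality up to a positive constant not depending on $u$. *)

theory Defs
  imports "HOL-Probability.Probability"
begin

definition log_shift :: "real \<Rightarrow> real" where
  "log_shift z = 1 + ln z"

text \<open>The functions \<open>f\<^sub>k\<close> for \<open>k \<ge> 1\<close>; the value at \<open>k = 0\<close> (the identity) is never used below.\<close>

definition iter_log :: "nat \<Rightarrow> real \<Rightarrow> real" where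
  "iter_log k = log_shift ^^ k"

definition gamma_density :: "real \<Rightarrow> real \<Rightarrow> real \<Rightarrow> real" where
  "gamma_density \<alpha> \<beta> t =
     (if t > 0 then \<beta> powr \<alpha> / Gamma \<alpha> * t powr (\<alpha> - 1) * exp (- \<beta> * t) else 0)"

definition log_beta_kernel :: "real \<Rightarrow> real \<Rightarrow> real \<Rightarrow> nat \<Rightarrow> real \<Rightarrow> real" where
  "log_beta_kernel a b \<gamma> L u =
     u powr (a - 1) / (1 + u) powr (a + b)
     * (\<Prod>k\<in>{1..<L}. 1 / iter_log k (1 + u))
     * (1 / iter_log L (1 + u) powr (1 + \<gamma>))"

text \<open>If the kernel were not integrable on \<open>(0, \<infinity>)\<close>, the normalizing integral would be \<open>0\<close> by
  convention and this function would vanish identically; it is a probability density only because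
  the kernel is integrable.\<close>

definition log_beta_density :: "real \<Rightarrow> real \<Rightarrow> real \<Rightarrow> nat \<Rightarrow> real \<Rightarrow> real" where
  "log_beta_density a b \<gamma> L u =
     (if u > 0 then log_beta_kernel a b \<gamma> L u /
        (LINT v:{0<..}|lborel. log_beta_kernel a b \<gamma> L v) else 0)"

text \<open>A vector \<open>(t\<^sub>0, \<dots>, t\<^sub>L)\<close> is a function on the index set \<open>{0..L}\<close>,
  and \<open>dt\<^sub>0 \<dots> dt\<^sub>L\<close> is the product of \<open>L + 1\<close> copies of Lebesgue measure.\<close>

definition GS :: "real \<Rightarrow> real \<Rightarrow> real \<Rightarrow> nat \<Rightarrow> (nat \<Rightarrow> real) \<Rightarrow> real" where
  "GS a b \<gamma> L t =
     gamma_density (1 + \<gamma>) 1 (t 0)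
     * (\<Prod>l\<in>{1..<L}. gamma_density (t (l - 1) + 1) 1 (t l))
     * gamma_density (t (L - 1) + a + b) 1 (t L)"

end

(* The gamma variables are integrated out from t_L down to t_0.  The Laplace transform of
   Ga(. | t + c, 1) at u is (1 + u)^(-c) exp(- t ln (1 + u)), so each integration produces one factor
   and replaces u by ln (1 + u); since f_k(1 + ln z) = f_(k+1)(z), the full integral is exactly the
   unnormalised density.  The latter is integrable since near 0 it is at most u^(a-1), and near
   infinity it is at most a constant times the derivative of - f_L(1 + u)^(-gamma) / gamma. *)

theory Submission
  imports Defs
begin

section \<open>Gamma densities: measurability, Laplace transform, integrating out one
  coordinate\<close>

lemma measurable_Gamma_real [measurable (raw)]:
  fixes f :: "'a \<Rightarrow> real"
  assumes [measurable]: "f \<in> borel_measurable M"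
  shows "(\<lambda>x. Gamma (f x)) \<in> borel_measurable M"
proof -
  \<comment> \<open>\<open>Gamma\<close> has poles at the nonpositive integers, so continuity gives
    nothing directly, but it is the inverse of the everywhere continuous \<open>rGamma\<close>.
    Measurability in the shape matters because each shape is itself a function of an integration
    variable.\<close>
  have [measurable]: "(rGamma :: real \<Rightarrow> real) \<in> borel_measurable borel"
    by (intro borel_measurable_continuous_onI continuous_on_rGamma)
  show ?thesis
    unfolding Gamma_def by measurable
qed

lemma measurable_gamma_density [measurable (raw)]:
  assumes [measurable]: "f \<in> borel_measurable M" "g \<in> borel_measurable M"
  shows "(\<lambda>x. gamma_density (f x) \<beta> (g x)) \<in> borel_measurable M"
  unfolding gamma_density_def by measurable

lemma gamma_density_nonneg: "\<alpha> > 0 \<Longrightarrow> \<beta> > 0 \<Longrightarrow> 0 \<le> gamma_density \<alpha> \<beta> t"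
  by (auto simp: gamma_density_def Gamma_real_pos less_imp_le)

text \<open>The factor \<open>exp (- y * s)\<close> only raises the rate from 1 to
  \<open>1 + s\<close>; rescaling by this positive number reduces the claim to Euler's integral.
  Nonnegative integrals make the result directly usable after Tonelli.\<close>

lemma nn_integral_gamma_density_laplace:
  fixes \<alpha> s :: real
  assumes \<alpha>: "\<alpha> > 0" and s: "s > -1"
  shows "(\<integral>\<^sup>+y. ennreal (indicator {0<..} y * exp (- y * s) * gamma_density \<alpha> 1 y) \<partial>lborel)
    = ennreal ((1 + s) powr - \<alpha>)"
proof -
  define G where "G = (\<lambda>t::real. indicator {0..} t * t powr (\<alpha> - 1) / exp t)"
  define K where "K = (1 + s) powr (1 - \<alpha>) / Gamma \<alpha>"
  have [measurable]: "G \<in> borel_measurable borel"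
    unfolding G_def by measurable
  have K: "K \<ge> 0"
    using \<alpha> by (simp add: K_def Gamma_real_pos less_imp_le)
  \<comment> \<open>Euler's integral after the substitution t = (1 + s) y, whose Jacobian is the
    leading factor \<open>1 + s\<close>.\<close>
  have \<Gamma>: "ennreal (Gamma \<alpha>) = ennreal (1 + s) * (\<integral>\<^sup>+y. ennreal (G ((1 + s) * y)) \<partial>lborel)"
    using Gamma_conv_nn_integral_real[OF \<alpha>] nn_integral_real_affine[of "\<lambda>t. ennreal (G t)" "1 + s" 0] s
    by (simp add: G_def)
  have eq: "indicator {0<..} y * exp (- y * s) * gamma_density \<alpha> 1 y = K * G ((1 + s) * y)" for y
  proof (cases "y > 0")
    case True
    have "(1 + s) powr (1 - \<alpha>) * (1 + s) powr (\<alpha> - 1) = 1"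
      using s by (simp flip: powr_add)
    moreover have "K * G ((1 + s) * y) = ((1 + s) powr (1 - \<alpha>) * (1 + s) powr (\<alpha> - 1))
        / Gamma \<alpha> * y powr (\<alpha> - 1) / exp ((1 + s) * y)"
      using s True by (simp add: G_def K_def powr_mult)
    ultimately have "K * G ((1 + s) * y) = y powr (\<alpha> - 1) / (Gamma \<alpha> * exp ((1 + s) * y))"
      by simp
    then show ?thesis
      using True by (simp add: gamma_density_def exp_add exp_minus divide_inverse algebra_simps)
  next
    case False
    \<comment> \<open>At \<open>y = 0\<close> the open and the closed half line differ, but
      \<open>0 powr (\<alpha> - 1)\<close> is 0, so both sides vanish there too.\<close>
    then show ?thesis
      using s by (cases "y = 0") (auto simp: G_def indicator_def zero_le_mult_iff)
  qed
  have "(\<integral>\<^sup>+y. ennreal (indicator {0<..} y * exp (- y * s) * gamma_density \<alpha> 1 y) \<partial>lborel)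
      = ennreal K * (\<integral>\<^sup>+y. ennreal (G ((1 + s) * y)) \<partial>lborel)"
    unfolding eq using K by (simp add: ennreal_mult' nn_integral_cmult)
  also have "\<dots> = ennreal (K / (1 + s)) * ennreal (1 + s) * (\<integral>\<^sup>+y. ennreal (G ((1 + s) * y)) \<partial>lborel)"
    using K s by (simp flip: ennreal_mult)
  also have "\<dots> = ennreal (K / (1 + s)) * ennreal (Gamma \<alpha>)"
    by (simp add: \<Gamma> mult.assoc)
  also have "\<dots> = ennreal (K / (1 + s) * Gamma \<alpha>)"
      using K s by (intro ennreal_mult'[symmetric]) simp
  also have "K / (1 + s) * Gamma \<alpha> = (1 + s) powr - \<alpha>"
    using powr_mult_base[of "1 + s" "- \<alpha>"] s Gamma_real_pos[OF \<alpha>]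
    by (simp add: K_def divide_eq_eq mult.commute)
  finally show ?thesis .
qed

text \<open>One step of the descent. Given the earlier coordinates, the last one has a gamma density
  of shape \<open>t n + c\<close>, and its Laplace transform splits into a constant and
  \<open>exp (- x n * ln (1 + u))\<close>: the integrand regains its form with one coordinate fewer
  and \<open>ln (1 + u)\<close> in place of \<open>u\<close>. \<open>H\<close> collects the earlier
  factors. Its sign is prescribed on the positive orthant only, since elsewhere a shape may be
  negative and make \<open>Gamma\<close> negative.\<close>

lemma nn_integral_last_gamma_coordinate:
  fixes H :: "(nat \<Rightarrow> real) \<Rightarrow> real" and c u :: real and n :: nat
  assumes c: "c \<ge> 0" and u: "u > 0"
    and [measurable]: "H \<in> borel_measurable (\<Pi>\<^sub>M l\<in>{0..Suc n}. lborel)"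
    and H_upd: "\<And>x y. H (x(Suc n := y)) = H x"
    and H_nonneg: "\<And>x. x \<in> (\<Pi>\<^sub>E l\<in>{0..n}. {0<..}) \<Longrightarrow> 0 \<le> H x"
  shows "(\<integral>\<^sup>+t. ennreal (indicator (\<Pi>\<^sub>E l\<in>{0..Suc n}. {0<..}) t
            * (exp (- t (Suc n) * u) * (H t * gamma_density (t n + c) 1 (t (Suc n)))))
            \<partial>(\<Pi>\<^sub>M l\<in>{0..Suc n}. lborel))
    = (\<integral>\<^sup>+x. ennreal (indicator (\<Pi>\<^sub>E l\<in>{0..n}. {0<..}) x
            * ((1 + u) powr - c * (exp (- x n * ln (1 + u)) * H x)))
            \<partial>(\<Pi>\<^sub>M l\<in>{0..n}. lborel))"
    (is "integral\<^sup>N _ ?F = integral\<^sup>N _ ?G")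
proof -
  interpret product_sigma_finite "\<lambda>_::nat. lborel :: real measure"
    by standard
  have ins: "{0..Suc n} = insert (Suc n) {0..n}"
    by auto
  have [measurable]: "(\<Pi>\<^sub>E l\<in>{0..Suc n}. {0<..}) \<in> sets (\<Pi>\<^sub>M l\<in>{0..Suc n}. (lborel :: real measure))"
    by (intro sets_PiM_I_finite) auto
  have [measurable]: "(\<lambda>t. t n) \<in> borel_measurable (\<Pi>\<^sub>M l\<in>{0..Suc n}. (lborel :: real measure))"
      "(\<lambda>t. t (Suc n)) \<in> borel_measurable (\<Pi>\<^sub>M l\<in>{0..Suc n}. (lborel :: real measure))"
    using measurable_component_singleton[of _ "{0..Suc n}" "\<lambda>_. lborel :: real measure"] by auto
  have F: "?F \<in> borel_measurable (\<Pi>\<^sub>M l\<in>{0..Suc n}. lborel)"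
    by measurable
  have "integral\<^sup>N (\<Pi>\<^sub>M l\<in>{0..Suc n}. lborel) ?F
      = (\<integral>\<^sup>+x. (\<integral>\<^sup>+y. ?F (x(Suc n := y)) \<partial>lborel) \<partial>(\<Pi>\<^sub>M l\<in>{0..n}. lborel))"
    using F unfolding ins by (intro product_nn_integral_insert) auto
  also have "\<dots> = integral\<^sup>N (\<Pi>\<^sub>M l\<in>{0..n}. lborel) ?G"
  proof (rule nn_integral_cong)
    fix x :: "nat \<Rightarrow> real"
    assume "x \<in> space (\<Pi>\<^sub>M l\<in>{0..n}. lborel)"
    then have ext: "x \<in> extensional {0..n}"
      by (simp add: space_PiM PiE_def)
    show "(\<integral>\<^sup>+y. ?F (x(Suc n := y)) \<partial>lborel) = ?G x"
    proof (cases "x \<in> (\<Pi>\<^sub>E l\<in>{0..n}. {0<..})")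
      case True
      then have pos: "x n > 0"
        by (auto simp: PiE_iff)
      have mem: "x(Suc n := y) \<in> (\<Pi>\<^sub>E l\<in>{0..Suc n}. {0<..}) \<longleftrightarrow> y > 0" for y
        using True by (auto simp: PiE_iff extensional_def le_Suc_eq)
      have "(\<integral>\<^sup>+y. ?F (x(Suc n := y)) \<partial>lborel)
          = (\<integral>\<^sup>+y. ennreal (H x) * ennreal (indicator {0<..} y * exp (- y * u)
              * gamma_density (x n + c) 1 y) \<partial>lborel)"
        using H_nonneg[OF True]
        by (intro nn_integral_cong) (auto simp: H_upd mem indicator_def mult_ac simp flip: ennreal_mult')
      also have "\<dots> = ennreal (H x) * ennreal ((1 + u) powr - (x n + c))"
        using nn_integral_gamma_density_laplace[of "x n + c" u] pos c u
        by (simp add: nn_integral_cmult)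
      also have "\<dots> = ennreal (H x * (1 + u) powr - (x n + c))"
        using H_nonneg[OF True] by (simp add: ennreal_mult')
      also have "H x * (1 + u) powr - (x n + c)
          = indicator (\<Pi>\<^sub>E l\<in>{0..n}. {0<..}) x * ((1 + u) powr - c * (exp (- x n * ln (1 + u)) * H x))"
        using True u by (simp add: powr_def exp_add exp_diff exp_minus field_simps)
      finally show ?thesis .
    next
      case False
      \<comment> \<open>Points of the product space are extensional, so the orthant can only be left
        through a nonpositive coordinate; this coordinate survives the update at
        \<open>Suc n\<close>.\<close>
      then obtain k where "k \<le> n" "x k \<le> 0"
        using ext by (auto simp: PiE_iff not_less)
      then have "x(Suc n := y) \<notin> (\<Pi>\<^sub>E l\<in>{0..Suc n}. {0<..})" for y
        by (auto simp: PiE_iff intro!: bexI[of _ k])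
      then show ?thesis
        using False by simp
    qed
  qed
  finally show ?thesis .
qed

text \<open>Once the last coordinate is split off, the factor of \<open>t n\<close> is a middle one,
  of shape \<open>t (n - 1) + 1\<close>. It is also the final factor of the shorter chain when a + b
  = 1, which explains the parameters \<open>1\<close> and \<open>0\<close>.\<close>

lemma GS_Suc:
  assumes "n \<ge> 1"
  shows "GS a b \<gamma> (Suc n) t = GS 1 0 \<gamma> n t * gamma_density (t n + (a + b)) 1 (t (Suc n))"
  using assms by (simp add: GS_def prod.atLeastLessThan_Suc add_ac mult_ac)

lemma measurable_GS:
  assumes "L \<le> m"
  shows "GS a b \<gamma> L \<in> borel_measurable (\<Pi>\<^sub>M l\<in>{0..m}. lborel)"
proof -
  have comp: "(\<lambda>t. t k) \<in> borel_measurable (\<Pi>\<^sub>M l\<in>{0..m}. (lborel :: real measure))" if "k \<le> m" for k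
    using measurable_component_singleton[of k "{0..m}" "\<lambda>_. lborel :: real measure"] that by auto
  show ?thesis
    unfolding GS_def using assms
    by (intro borel_measurable_times borel_measurable_prod measurable_gamma_density
        borel_measurable_add borel_measurable_const comp) auto
qed

lemma GS_nonneg:
  assumes "a + b \<ge> 0" "\<gamma> > -1" and t: "t \<in> (\<Pi>\<^sub>E l\<in>{0..L}. {0<..})"
  shows "0 \<le> GS a b \<gamma> L t"
proof -
  have "t l > 0" if "l \<le> L" for l
    using t that by (auto simp: PiE_iff)
  then have "t (L - 1) > 0" "\<And>l. l \<in> {1..<L} \<Longrightarrow> t (l - 1) > 0"
    by auto
  then show ?thesis
    unfolding GS_def using assms(1,2)
    by (intro mult_nonneg_nonneg prod_nonneg ballI gamma_density_nonneg)
      (auto simp: add_pos_pos add.assoc intro: add_pos_nonneg)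
qed

section \<open>Iterated logarithms and the Laplace transform of the whole chain\<close>

lemma iter_log_0 [simp]: "iter_log 0 z = z"
  by (simp add: iter_log_def)

lemma iter_log_Suc: "iter_log (Suc k) z = 1 + ln (iter_log k z)"
  by (simp add: iter_log_def log_shift_def)

text \<open>Iterates of one function commute, so the extra logarithm may be applied first. This
  turns the replacement of \<open>u\<close> by \<open>ln (1 + u)\<close> into a shift of the
  index.\<close>

lemma iter_log_shift: "iter_log k (1 + ln z) = iter_log (Suc k) z"
  by (simp add: iter_log_def funpow_swap1 log_shift_def)

lemma iter_log_ge_1: "z \<ge> 1 \<Longrightarrow> iter_log k z \<ge> 1"
  by (induction k) (auto simp: iter_log_Suc)

lemma measurable_iter_log [measurable]: "iter_log k \<in> borel_measurable borel"
proof (induction k)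
  case (Suc k)
  note [measurable] = Suc
  show ?case
    unfolding iter_log_Suc[abs_def] by measurable
qed (simp add: iter_log_def)

text \<open>Induction on the length of the chain. Integrating out the last coordinate leaves the
  shorter chain with parameters \<open>1\<close> and \<open>0\<close>, evaluated at
  \<open>ln (1 + u)\<close>; hence \<open>a\<close>, \<open>b\<close> and \<open>u\<close> must stay
  arbitrary.\<close>

lemma nn_integral_GS_laplace:
  fixes a b \<gamma> u :: real
  assumes "L \<ge> 1" and "a + b \<ge> 0" and "\<gamma> > -1" and "u > 0"
  shows "(\<integral>\<^sup>+t. ennreal (indicator (\<Pi>\<^sub>E l\<in>{0..L}. {0<..}) t * (exp (- t L * u) * GS a b \<gamma> L t))
            \<partial>(\<Pi>\<^sub>M l\<in>{0..L}. lborel))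
    = ennreal (1 / (1 + u) powr (a + b) * (\<Prod>k\<in>{1..<L}. 1 / iter_log k (1 + u))
        * (1 / iter_log L (1 + u) powr (1 + \<gamma>)))"
  using assms
proof (induction L arbitrary: a b u rule: nat_induct_at_least)
  case base
  interpret product_sigma_finite "\<lambda>_::nat. lborel :: real measure"
    by standard
  let ?H = "\<lambda>t::nat \<Rightarrow> real. gamma_density (1 + \<gamma>) 1 (t 0)"
  let ?w = "ln (1 + u)"
  have H: "?H \<in> borel_measurable (\<Pi>\<^sub>M l\<in>{0..Suc 0}. lborel)"
    by (intro measurable_gamma_density borel_measurable_const)
      (use measurable_component_singleton[of 0 "{0..Suc 0}" "\<lambda>_. lborel :: real measure"] in auto)
  have w: "?w > 0"
    using base by simp
  have "(\<integral>\<^sup>+t. ennreal (indicator (\<Pi>\<^sub>E l\<in>{0..1}. {0<..}) t * (exp (- t 1 * u) * GS a b \<gamma> 1 t))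
            \<partial>(\<Pi>\<^sub>M l\<in>{0..1}. lborel))
    = (\<integral>\<^sup>+t. ennreal (indicator (\<Pi>\<^sub>E l\<in>{0..Suc 0}. {0<..}) t
            * (exp (- t (Suc 0) * u) * (?H t * gamma_density (t 0 + (a + b)) 1 (t (Suc 0)))))
            \<partial>(\<Pi>\<^sub>M l\<in>{0..Suc 0}. lborel))"
    by (simp only: GS_def) (simp add: add.assoc)
  also have "\<dots> = (\<integral>\<^sup>+x. ennreal (indicator (\<Pi>\<^sub>E l\<in>{0..0}. {0<..}) x
            * ((1 + u) powr - (a + b) * (exp (- x 0 * ?w) * ?H x))) \<partial>(\<Pi>\<^sub>M l\<in>{0..0}. lborel))"
  proof (rule nn_integral_last_gamma_coordinate[where n = 0 and H = ?H])
    show "0 \<le> ?H x" for x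
      using base by (intro gamma_density_nonneg) auto
  qed (use base H in auto)
  also have "\<dots> = (\<integral>\<^sup>+x. ennreal ((1 + u) powr - (a + b)) * ennreal (indicator {0<..} (x 0)
            * exp (- x 0 * ?w) * gamma_density (1 + \<gamma>) 1 (x 0)) \<partial>(\<Pi>\<^sub>M l\<in>{0::nat}. lborel))"
    unfolding atLeastAtMost_singleton
  proof (rule nn_integral_cong)
    fix x :: "nat \<Rightarrow> real"
    assume "x \<in> space (\<Pi>\<^sub>M l\<in>{0::nat}. lborel)"
    then have "x \<in> (\<Pi>\<^sub>E l\<in>{0}. {0<..}) \<longleftrightarrow> x 0 > 0"
      by (auto simp: space_PiM PiE_iff)
    then show "ennreal (indicator (\<Pi>\<^sub>E l\<in>{0}. {0<..}) x
          * ((1 + u) powr - (a + b) * (exp (- x 0 * ?w) * ?H x)))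
        = ennreal ((1 + u) powr - (a + b))
          * ennreal (indicator {0<..} (x 0) * exp (- x 0 * ?w) * gamma_density (1 + \<gamma>) 1 (x 0))"
      by (cases "x 0 > 0") (simp_all add: mult.assoc flip: ennreal_mult')
  qed
  also have "\<dots> = (\<integral>\<^sup>+y. ennreal ((1 + u) powr - (a + b)) * ennreal (indicator {0<..} y
            * exp (- y * ?w) * gamma_density (1 + \<gamma>) 1 y) \<partial>lborel)"
    by (rule product_nn_integral_singleton) measurable
  \<comment> \<open>The second Laplace transform, now of the density of \<open>t 0\<close> at
    \<open>ln (1 + u)\<close>, yields the last factor, because \<open>1 + ?w\<close> is
    \<open>iter_log 1 (1 + u)\<close>.\<close>
  also have "\<dots> = ennreal ((1 + u) powr - (a + b)) * ennreal ((1 + ?w) powr - (1 + \<gamma>))"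
    using nn_integral_gamma_density_laplace[of "1 + \<gamma>" ?w] base w
    by (simp add: nn_integral_cmult)
  also have "\<dots> = ennreal (1 / (1 + u) powr (a + b) * (1 / iter_log 1 (1 + u) powr (1 + \<gamma>)))"
    by (simp add: iter_log_Suc powr_minus divide_inverse del: minus_add_distrib flip: ennreal_mult')
  finally show ?case
    by simp
next
  case (Suc n)
  let ?w = "ln (1 + u)"
  have w: "?w > 0"
    using Suc.prems by simp
  have upd: "GS 1 0 \<gamma> n (x(Suc n := y)) = GS 1 0 \<gamma> n x" for x y
    using Suc.hyps by (auto simp: GS_def intro!: prod.cong arg_cong2[where f = "(*)"])
  have [measurable]: "GS 1 0 \<gamma> n \<in> borel_measurable (\<Pi>\<^sub>M l\<in>{0..n}. lborel)"
    by (rule measurable_GS) simp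
  have [measurable]: "(\<Pi>\<^sub>E l\<in>{0..n}. {0<..}) \<in> sets (\<Pi>\<^sub>M l\<in>{0..n}. (lborel :: real measure))"
    by (intro sets_PiM_I_finite) auto
  have [measurable]: "(\<lambda>t. t n) \<in> borel_measurable (\<Pi>\<^sub>M l\<in>{0..n}. (lborel :: real measure))"
    using measurable_component_singleton[of n "{0..n}" "\<lambda>_. lborel :: real measure"] by auto
  have "(\<integral>\<^sup>+t. ennreal (indicator (\<Pi>\<^sub>E l\<in>{0..Suc n}. {0<..}) t
          * (exp (- t (Suc n) * u) * GS a b \<gamma> (Suc n) t)) \<partial>(\<Pi>\<^sub>M l\<in>{0..Suc n}. lborel))
      = (\<integral>\<^sup>+x. ennreal (indicator (\<Pi>\<^sub>E l\<in>{0..n}. {0<..}) x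
            * ((1 + u) powr - (a + b) * (exp (- x n * ?w) * GS 1 0 \<gamma> n x))) \<partial>(\<Pi>\<^sub>M l\<in>{0..n}. lborel))"
    unfolding GS_Suc[OF Suc.hyps] using Suc.prems
    by (intro nn_integral_last_gamma_coordinate measurable_GS upd GS_nonneg) auto
  also have "\<dots> = (\<integral>\<^sup>+x. ennreal ((1 + u) powr - (a + b)) * ennreal (indicator (\<Pi>\<^sub>E l\<in>{0..n}. {0<..}) x
            * (exp (- x n * ?w) * GS 1 0 \<gamma> n x)) \<partial>(\<Pi>\<^sub>M l\<in>{0..n}. lborel))"
    by (intro nn_integral_cong) (auto simp: mult_ac simp flip: ennreal_mult')
  also have "\<dots> = ennreal ((1 + u) powr - (a + b)) * (\<integral>\<^sup>+x. ennreal (indicator (\<Pi>\<^sub>E l\<in>{0..n}. {0<..}) x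
            * (exp (- x n * ?w) * GS 1 0 \<gamma> n x)) \<partial>(\<Pi>\<^sub>M l\<in>{0..n}. lborel))"
    by (rule nn_integral_cmult) measurable
  also have "\<dots> = ennreal ((1 + u) powr - (a + b)) * ennreal (1 / (1 + ?w) powr (1 + 0)
        * (\<Prod>k\<in>{1..<n}. 1 / iter_log k (1 + ?w)) * (1 / iter_log n (1 + ?w) powr (1 + \<gamma>)))"
    using Suc.prems w by (subst Suc.IH) auto
  \<comment> \<open>Since \<open>iter_log 0\<close> is the identity, the factor with exponent 1 is
    the missing term of index 0. The shift by one index then gives the product for
    \<open>Suc n\<close>.\<close>
  also have "1 / (1 + ?w) powr (1 + 0) * (\<Prod>k\<in>{1..<n}. 1 / iter_log k (1 + ?w))
      = (\<Prod>k\<in>{0..<n}. 1 / iter_log k (1 + ?w))"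
    using Suc.hyps w by (simp add: prod.atLeast_Suc_lessThan)
  also have "\<dots> = (\<Prod>k\<in>{1..<Suc n}. 1 / iter_log k (1 + u))"
    by (simp add: iter_log_shift prod.shift_bounds_Suc_ivl del: One_nat_def prod.op_ivl_Suc
        flip: One_nat_def)
      (simp add: prod.shift_bounds_Suc_ivl del: prod.op_ivl_Suc)
  finally show ?case
    by (simp add: iter_log_shift powr_minus divide_inverse mult.assoc
        del: minus_add_distrib prod.op_ivl_Suc flip: ennreal_mult')
qed

section \<open>Integrability of the unnormalised density\<close>

lemma DERIV_iter_log:
  assumes "z \<ge> 1"
  shows "(iter_log k has_real_derivative (\<Prod>j<k. 1 / iter_log j z)) (at z)"
proof (induction k)
  case 0
  then show ?case
    by (auto simp: iter_log_def intro!: derivative_eq_intros)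
next
  case (Suc k)
  show ?case
    unfolding iter_log_Suc[abs_def] using iter_log_ge_1[OF assms, of k]
    by (auto intro!: derivative_eq_intros Suc)
qed

lemma filterlim_iter_log: "filterlim (iter_log k) at_top at_top"
proof (induction k)
  case 0
  then show ?case
    by (simp add: iter_log_def filterlim_ident eq_id_iff[symmetric])
next
  case (Suc k)
  show ?case
    unfolding iter_log_Suc[abs_def]
    by (intro filterlim_tendsto_add_at_top[OF tendsto_const] filterlim_compose[OF ln_at_top Suc])
qed

text \<open>By the chain rule the derivative of \<open>iter_log L\<close> is the product of the
  reciprocals of the lower iterates, including index 0. The integrand is therefore the derivative of
  \<open>?F\<close>, which tends to 0 at infinity because \<open>\<gamma>\<close> is
  positive.\<close>

lemma nn_integral_iter_log_tail:
  fixes \<gamma> :: real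
  assumes "\<gamma> > 0"
  shows "(\<integral>\<^sup>+u. ennreal ((\<Prod>k<L. 1 / iter_log k (1 + u)) * iter_log L (1 + u) powr - (1 + \<gamma>))
      * indicator {0..} u \<partial>lborel) < \<infinity>"
proof -
  let ?g = "\<lambda>u::real. (\<Prod>k<L. 1 / iter_log k (1 + u)) * iter_log L (1 + u) powr - (1 + \<gamma>)"
  let ?F = "\<lambda>u::real. - (1 / \<gamma>) * iter_log L (1 + u) powr - \<gamma>"
  have "(\<integral>\<^sup>+u. ennreal (?g u) * indicator {0..} u \<partial>lborel) = ennreal (0 - ?F 0)"
  proof (rule nn_integral_FTC_atLeast)
    show "?g \<in> borel_measurable borel"
      by measurable
  next
    fix x :: real
    assume x: "0 \<le> x"
    then have ge: "iter_log k (1 + x) \<ge> 1" for k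
      by (intro iter_log_ge_1) simp
    then have pos: "iter_log L (1 + x) > 0"
      by (rule less_le_trans[OF zero_less_one])
    have "((\<lambda>u. iter_log L (1 + u)) has_real_derivative (\<Prod>k<L. 1 / iter_log k (1 + x))) (at x)"
      using DERIV_iter_log[of "1 + x" L] x DERIV_shift[of "iter_log L" _ x 1]
      by (simp add: add.commute[of 1])
    from has_real_derivative_powr[OF pos, of "- \<gamma>"] this
    have "((\<lambda>u. iter_log L (1 + u) powr - \<gamma>) has_real_derivative
        - \<gamma> * iter_log L (1 + x) powr (- \<gamma> - 1) * (\<Prod>k<L. 1 / iter_log k (1 + x))) (at x)"
      by (rule DERIV_chain2)
    from DERIV_cmult[OF this, of "- (1 / \<gamma>)"]
    show "DERIV ?F x :> ?g x"
      using assms by (simp add: minus_diff_commute mult.commute)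
    show "0 \<le> ?g x"
      using ge by (intro mult_nonneg_nonneg prod_nonneg)
        (auto intro: order_trans[OF zero_le_one])
  next
    have "filterlim (\<lambda>u::real. iter_log L (1 + u)) at_top at_top"
      by (rule filterlim_compose[OF filterlim_iter_log]) real_asymp
    then have "((\<lambda>u. iter_log L (1 + u) powr - \<gamma>) \<longlongrightarrow> 0) at_top"
      using assms by (intro tendsto_neg_powr) auto
    from tendsto_mult_left[OF this, of "- (1 / \<gamma>)"] show "(?F \<longlongrightarrow> 0) at_top"
      by simp
  qed
  then show ?thesis
    by simp
qed

lemma log_beta_kernel_pos:
  assumes "u > 0"
  shows "log_beta_kernel a b \<gamma> L u > 0"
proof -
  have "iter_log k (1 + u) > 0" for k
    using iter_log_ge_1[of "1 + u" k] assms by linarith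
  then show ?thesis
    unfolding log_beta_kernel_def using assms
    by (intro mult_pos_pos prod_pos) (auto simp: less_imp_neq[symmetric] dest: less_imp_neq)
qed

lemma measurable_log_beta_kernel [measurable]: "log_beta_kernel a b \<gamma> L \<in> borel_measurable borel"
  unfolding log_beta_kernel_def by measurable

text \<open>Two integrable majorants are added so that one bound serves the whole half line. For
  \<open>u \<le> 1\<close> the first, a multiple of Euler's integrand for \<open>Gamma a\<close>,
  suffices, as \<open>exp 1 / exp u\<close> is at least 1. For \<open>u > 1\<close> the second, a
  multiple of the exact derivative integrated above, suffices.\<close>

lemma log_beta_kernel_le:
  fixes a b \<gamma> u :: real
  assumes "a > 0" and "b \<ge> 0" and "\<gamma> > 0" and "L \<ge> 1" and u: "u > 0"
  shows "log_beta_kernel a b \<gamma> L u \<le> exp 1 * (u powr (a - 1) / exp u)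
    + max 1 (2 powr (1 - a)) * ((\<Prod>k<L. 1 / iter_log k (1 + u)) * iter_log L (1 + u) powr - (1 + \<gamma>))"
    (is "_ \<le> ?A + ?c * ?g")
proof -
  have ge: "iter_log k (1 + u) \<ge> 1" for k
    using u by (intro iter_log_ge_1) simp
  then have pos: "iter_log k (1 + u) > 0" for k
    by (rule less_le_trans[OF zero_less_one])
  \<comment> \<open>The purely logarithmic part; it lies in [0, 1] because all iterates are at least
    1.\<close>
  define R where "R = (\<Prod>k\<in>{1..<L}. 1 / iter_log k (1 + u)) * iter_log L (1 + u) powr - (1 + \<gamma>)"
  have R0: "R \<ge> 0"
    unfolding R_def using pos by (intro mult_nonneg_nonneg prod_nonneg) (auto simp: less_imp_le)
  have R1: "R \<le> 1"
    unfolding R_def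
  proof (rule mult_le_one)
    show "(\<Prod>k\<in>{1..<L}. 1 / iter_log k (1 + u)) \<le> 1"
      using ge pos by (intro prod_le_1) (auto simp: less_imp_le divide_le_eq_1)
    show "iter_log L (1 + u) powr - (1 + \<gamma>) \<le> 1"
      using powr_mono[of "- (1 + \<gamma>)" 0 "iter_log L (1 + u)"] ge[of L] pos[of L] assms by simp
  qed simp
  have k: "log_beta_kernel a b \<gamma> L u = u powr (a - 1) / (1 + u) powr (a + b) * R"
    unfolding log_beta_kernel_def R_def
    by (simp add: powr_minus divide_inverse mult_ac del: minus_add_distrib)
  \<comment> \<open>\<open>L \<ge> 1\<close> allows the index 0 factor, \<open>1 / (1 + u)\<close>,
    to be split off.\<close>
  have g: "?g = 1 / (1 + u) * R"
    unfolding R_def lessThan_atLeast0 using assms by (simp add: prod.atLeast_Suc_lessThan)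
  have A0: "?A \<ge> 0" and g0: "?c * ?g \<ge> 0"
    unfolding g using R0 u by (auto intro!: mult_nonneg_nonneg)
  show ?thesis
  proof (cases "u \<le> 1")
    case True
    have "u powr (a - 1) / (1 + u) powr (a + b) * R \<le> u powr (a - 1) / 1 * 1"
      using R0 R1 assms by (intro mult_mono divide_left_mono) (auto intro!: ge_one_powr_ge_zero)
    also have "\<dots> \<le> u powr (a - 1) * (exp 1 / exp u)"
      using True mult_left_mono[of 1 "exp 1 / exp u" "u powr (a - 1)"] by simp
    also have "\<dots> = ?A"
      by simp
    finally show ?thesis
      unfolding k using g0 by linarith
  next
    case False
    have "u powr (a - 1) / (1 + u) powr (a + b) \<le> u powr (a - 1) / (1 + u) powr a"
      using assms by (intro divide_left_mono powr_mono) auto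
    \<comment> \<open>This isolates the decay \<open>1 / (1 + u)\<close> needed for the tail; what
      remains is a power of a number in (0, 1).\<close>
    also have "\<dots> = (u / (1 + u)) powr (a - 1) * (1 / (1 + u))"
      using u by (simp add: powr_divide powr_diff)
    also have "(u / (1 + u)) powr (a - 1) \<le> ?c"
    proof (cases "a \<ge> 1")
      case True
      then have "(u / (1 + u)) powr (a - 1) \<le> 1"
        using u by (intro powr_le1) auto
      then show ?thesis
        by simp
    next
      case a: False
      \<comment> \<open>The exponent is negative and \<open>u > 1\<close> gives u / (1 + u) > 1/2,
        whence the constant \<open>2 powr (1 - a)\<close>.\<close>
      have "(u / (1 + u)) powr (a - 1) \<le> (1 / 2) powr (a - 1)"
        using False a by (intro powr_mono2') (auto simp: field_simps)
      also have "\<dots> = 2 powr (1 - a)"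
        by (simp add: powr_divide powr_diff)
      finally show ?thesis
        by simp
    qed
    finally have "u powr (a - 1) / (1 + u) powr (a + b) \<le> ?c * (1 / (1 + u))"
      using u by (simp add: divide_right_mono)
    from mult_right_mono[OF this R0] show ?thesis
      unfolding k g using A0 by (simp only: mult.assoc)
  qed
qed

lemma nn_integral_log_beta_kernel_finite:
  fixes a b \<gamma> :: real
  assumes "a > 0" and "b \<ge> 0" and "\<gamma> > 0" and "L \<ge> 1"
  shows "(\<integral>\<^sup>+u. ennreal (indicator {0<..} u * log_beta_kernel a b \<gamma> L u) \<partial>lborel) < \<infinity>"
proof -
  let ?h = "\<lambda>u::real. ennreal (indicator {0..} u * u powr (a - 1) / exp u)"
  let ?g = "\<lambda>u::real. ennreal ((\<Prod>k<L. 1 / iter_log k (1 + u)) * iter_log L (1 + u) powr - (1 + \<gamma>))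
      * indicator {0..} u"
  let ?c = "max 1 (2 powr (1 - a))"
  have "(\<integral>\<^sup>+u. ennreal (indicator {0<..} u * log_beta_kernel a b \<gamma> L u) \<partial>lborel)
      \<le> (\<integral>\<^sup>+u. ennreal (exp 1) * ?h u + ennreal ?c * ?g u \<partial>lborel)"
  proof (rule nn_integral_mono)
    fix u :: real
    show "ennreal (indicator {0<..} u * log_beta_kernel a b \<gamma> L u)
        \<le> ennreal (exp 1) * ?h u + ennreal ?c * ?g u"
    proof (cases "u > 0")
      case True
      have "0 \<le> iter_log k (1 + u)" for k
        using iter_log_ge_1[of "1 + u" k] True by linarith
      then have "0 \<le> (\<Prod>k<L. 1 / iter_log k (1 + u)) * iter_log L (1 + u) powr - (1 + \<gamma>)"
        by (intro mult_nonneg_nonneg prod_nonneg) auto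
      then show ?thesis
        using log_beta_kernel_le[OF assms True] True
        by (simp del: minus_add_distrib flip: ennreal_mult ennreal_plus)
    qed simp
  qed
  also have "\<dots> = ennreal (exp 1) * integral\<^sup>N lborel ?h + ennreal ?c * integral\<^sup>N lborel ?g"
    by (simp add: nn_integral_add nn_integral_cmult del: minus_add_distrib)
  also have "\<dots> < \<infinity>"
    using nn_integral_iter_log_tail[OF assms(3), of L] assms(1)
    by (simp add: ennreal_mult_less_top flip: Gamma_conv_nn_integral_real del: minus_add_distrib)
  finally show ?thesis .
qed

section \<open>Normalisation and the mixture representation\<close>

theorem mainTheorem5:
  fixes a b \<gamma> :: real and L :: nat
  assumes "a > 0" and "b \<ge> 0" and "\<gamma> > 0" and "L \<ge> 1"
  shows "(\<forall>u. 0 \<le> log_beta_density a b \<gamma> L u)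
    \<and> prob_space (density lborel (\<lambda>u. ennreal (log_beta_density a b \<gamma> L u)))
    \<and> (\<forall>u>0. set_integrable (\<Pi>\<^sub>M l\<in>{0..L}. lborel) (\<Pi>\<^sub>E l\<in>{0..L}. {0<..})
          (\<lambda>t. u powr (a - 1) * exp (- t L * u) * GS a b \<gamma> L t))
    \<and> (\<exists>C>0. \<forall>u>0. log_beta_density a b \<gamma> L u =
          C * (LINT t:(\<Pi>\<^sub>E l\<in>{0..L}. {0<..})|(\<Pi>\<^sub>M l\<in>{0..L}. lborel).
                 u powr (a - 1) * exp (- t L * u) * GS a b \<gamma> L t))"
proof -
  let ?K = "\<lambda>u. indicator {0<..} u * log_beta_kernel a b \<gamma> L u"
  define Z where "Z = (LINT v:{0<..}|lborel. log_beta_kernel a b \<gamma> L v)"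
  have K0: "?K u \<ge> 0" for u
    by (cases "u > 0") (auto simp: log_beta_kernel_pos less_imp_le)
  \<comment> \<open>Integrability ensures that \<open>Z\<close> is the true integral and not the
    default value 0.\<close>
  have int: "integrable lborel ?K"
    using nn_integral_log_beta_kernel_finite[OF assms] K0 by (intro integrableI_nonneg) auto
  have Z: "Z = integral\<^sup>L lborel ?K"
    by (simp add: Z_def set_lebesgue_integral_def)
  \<comment> \<open>A vanishing integral of a nonnegative function forces it to vanish almost
    everywhere, but the kernel is strictly positive on the half line, which is not a null
    set.\<close>
  have "Z \<noteq> 0"
  proof
    assume "Z = 0"
    then have "AE u in lborel. ?K u = 0"
      using integral_nonneg_eq_0_iff_AE[OF int] K0 Z by simp
    then have "AE u in lborel. u \<notin> {0<..(1::real)}"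
      by eventually_elim (auto simp: log_beta_kernel_pos less_imp_neq[symmetric])
    then have "{0<..(1::real)} \<in> null_sets lborel"
      by (subst AE_iff_null_sets) auto
    then show False
      by (simp add: null_sets_def)
  qed
  moreover have "Z \<ge> 0"
    unfolding Z using K0 by (intro integral_nonneg_AE) auto
  ultimately have Z0: "Z > 0"
    by simp
  have dens: "log_beta_density a b \<gamma> L u = ?K u / Z" for u
    by (simp add: log_beta_density_def Z_def)
  have dens0: "0 \<le> log_beta_density a b \<gamma> L u" for u
    unfolding dens using K0 Z0 by (intro divide_nonneg_pos)
  have "(\<integral>\<^sup>+u. ennreal (log_beta_density a b \<gamma> L u) \<partial>lborel) = ennreal (integral\<^sup>L lborel (\<lambda>u. ?K u / Z))"
    unfolding dens using int K0 Z0 by (intro nn_integral_eq_integral) (auto intro: divide_nonneg_pos)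
  also have "\<dots> = 1"
    using Z0 Z by simp
  finally have prob: "prob_space (density lborel (\<lambda>u. ennreal (log_beta_density a b \<gamma> L u)))"
    by (intro prob_spaceI) (simp add: emeasure_density dens[abs_def])
  let ?M = "\<Pi>\<^sub>M l\<in>{0..L}. (lborel :: real measure)"
  let ?S = "\<Pi>\<^sub>E l\<in>{0..L}. {0<..} :: real set"
  let ?f = "\<lambda>u t. u powr (a - 1) * exp (- t L * u) * GS a b \<gamma> L t"
  have [measurable]: "GS a b \<gamma> L \<in> borel_measurable ?M"
    by (rule measurable_GS) simp
  have [measurable]: "?S \<in> sets ?M"
    by (intro sets_PiM_I_finite) auto
  have [measurable]: "(\<lambda>t. t L) \<in> borel_measurable ?M"
    using measurable_component_singleton[of L "{0..L}" "\<lambda>_. lborel :: real measure"] by auto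
  have f0: "0 \<le> indicator ?S t *\<^sub>R ?f u t" for u t
    using GS_nonneg[of a b \<gamma> t L] assms by (cases "t \<in> ?S") auto
  \<comment> \<open>The nonnegative integral is computed first: its finite value supplies both
    integrability and the value of the Lebesgue integral.\<close>
  have nn: "(\<integral>\<^sup>+t. ennreal (indicator ?S t *\<^sub>R ?f u t) \<partial>?M) = ennreal (log_beta_kernel a b \<gamma> L u)"
    if u: "u > 0" for u
  proof -
    have "(\<integral>\<^sup>+t. ennreal (indicator ?S t *\<^sub>R ?f u t) \<partial>?M)
        = (\<integral>\<^sup>+t. ennreal (u powr (a - 1))
            * ennreal (indicator ?S t * (exp (- t L * u) * GS a b \<gamma> L t)) \<partial>?M)"
      by (intro nn_integral_cong) (auto simp: mult_ac simp flip: ennreal_mult')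
    also have "\<dots> = ennreal (u powr (a - 1))
            * (\<integral>\<^sup>+t. ennreal (indicator ?S t * (exp (- t L * u) * GS a b \<gamma> L t)) \<partial>?M)"
      by (rule nn_integral_cmult) measurable
    also have "\<dots> = ennreal (log_beta_kernel a b \<gamma> L u)"
      using assms u by (subst nn_integral_GS_laplace)
        (auto simp: log_beta_kernel_def mult.assoc simp flip: ennreal_mult')
    finally show ?thesis .
  qed
  have integ: "set_integrable ?M ?S (?f u)" if "u > 0" for u
    unfolding set_integrable_def using f0 nn[OF that] by (intro integrableI_nonneg) auto
  have val: "(LINT t:?S|?M. ?f u t) = log_beta_kernel a b \<gamma> L u" if "u > 0" for u
    unfolding set_lebesgue_integral_def using f0 nn[OF that] log_beta_kernel_pos[OF that, of a b \<gamma> L]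
    by (subst integral_eq_nn_integral) auto
  have "\<exists>C>0. \<forall>u>0. log_beta_density a b \<gamma> L u = C * (LINT t:?S|?M. ?f u t)"
    \<comment> \<open>The mixture integral equals the kernel exactly, so the proportionality
      constant is the reciprocal of the normalising integral.\<close>
    using Z0 val by (intro exI[of _ "1 / Z"]) (simp add: dens)
  then show ?thesis
    using dens0 prob integ by blast
qed

end
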